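(* Let $G=(V,E)$, $V=V_1\cup V_2$, $V_1\cap V_2=\emptyset$, be a design graph with parameters $(m,d,c)$, where $V_1,V_2$ are the two parts of the bipartition. Let $v$ be a vertex in $V_1$. Then the partition $$\pi_2=\{O_1=\{v\},\ O_2=V_1\setminus O_1,\ O_3=N(v),\ O_4=V_2\setminus O_3\},$$ where $N(v)$ is the set of neighbors of $v$, is a distance equitable partition of $V$, and the following matrix $P=(p_{ij})_{4\times 4}$ (rows and columns indexed by $O_1,O_2,O_3,O_4$ in this order) is the quotient matrix of the distance matrix of $G$ over $\pi_2$: $$P=P(m,d,c)=\begin{pmatrix} 0&2m-2&d&3m-3d\\ 2&2m-4&3d-2c&3m-5d+2c\\ 1&3m-2d-1&2d-2&2m-2d\\ 3&3m-2d-3&2d&2m-2d-2 \end{pmatrix}.$$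
   Context: All graphs are finite, simple and undirected. A design graph with parameters $(m,d,c)$, $c\neq 0$, is a $d$-regular bipartite graph of order $2m$ (so each part has $m$ vertices) in which any two distinct vertices of the same part have exactly $c$ common neighbors; the complete bipartite graph $K_{n,n}$ is excluded by convention. Let $d(u,w)$ denote graph distance. A partition $\Pi=\{V'_1,\dots,V'_k\}$ of the vertex set is a distance equitable partition if for all $i,j$ the sum $\sum_{w\in V'_j} d(u,w)$ is the same for every $u\in V'_i$; the quotient matrix of the distance matrix over $\Pi$ is the $k\times k$ matrix with $(i,j)$ entry $p_{ij}=\sum_{w\in V'_j} d(u,w)$ for any fixed $u\in V'_i$. *)

theory Defs
  imports
    "Graph_Theory.Shortest_Path"
    "Graph_Theory.Kuratowski"
    "Jordan_Normal_Form.Matrix"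
    "HOL-Library.Disjoint_Sets"
begin

text \<open>Finite simple undirected graphs are finite symmetric digraphs without loops and parallel
  arcs (locale \<open>graph\<close>); an edge is a pair of opposite arcs.\<close>

definition nbhd :: "('a, 'b) pre_digraph \<Rightarrow> 'a \<Rightarrow> 'a set" where
  "nbhd G v = {w. v \<rightarrow>\<^bsub>G\<^esub> w}"

definition graph_dist :: "('a, 'b) pre_digraph \<Rightarrow> 'a \<Rightarrow> 'a \<Rightarrow> ereal" where
  "graph_dist G u w = wf_digraph.\<mu> G (\<lambda>_. 1) u w"

definition bipartition :: "('a, 'b) pre_digraph \<Rightarrow> 'a set \<Rightarrow> 'a set \<Rightarrow> bool" where
  "bipartition G V1 V2 \<longleftrightarrow>
     verts G = V1 \<union> V2 \<and> V1 \<inter> V2 = {} \<and>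
     (\<forall>u w. u \<rightarrow>\<^bsub>G\<^esub> w \<longrightarrow> (u \<in> V1 \<and> w \<in> V2) \<or> (u \<in> V2 \<and> w \<in> V1))"

text \<open>The parameter \<open>c\<close> is meaningful only if some part contains two distinct vertices, hence
  \<open>2 \<le> m\<close>. For \<open>m = 1\<close> the condition on common neighbours would be vacuous for every \<open>c\<close>, which
  would admit the disconnected graph consisting of two isolated vertices (\<open>d = 0\<close>).\<close>

definition design_graph ::
  "('a, 'b) pre_digraph \<Rightarrow> 'a set \<Rightarrow> 'a set \<Rightarrow> nat \<Rightarrow> nat \<Rightarrow> nat \<Rightarrow> bool" where
  "design_graph G V1 V2 m d c \<longleftrightarrow>
     graph G \<and> bipartition G V1 V2 \<and>
     card (verts G) = 2 * m \<and> 2 \<le> m \<and>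
     (\<forall>u \<in> verts G. out_degree G u = d) \<and>
     c \<noteq> 0 \<and>
     (\<forall>X \<in> {V1, V2}. \<forall>x \<in> X. \<forall>y \<in> X. x \<noteq> y \<longrightarrow> card (nbhd G x \<inter> nbhd G y) = c) \<and>
     \<not> (\<exists>n. complete_bipartite_digraph n n G)"

text \<open>Partitions are given as lists of cells, which fixes the indexing of the quotient matrix.\<close>

definition distance_equitable_partition ::
  "('a, 'b) pre_digraph \<Rightarrow> 'a set list \<Rightarrow> bool" where
  "distance_equitable_partition G Vs \<longleftrightarrow>
     distinct Vs \<and> partition_on (verts G) (set Vs) \<and>
     (\<forall>i < length Vs. \<forall>j < length Vs. \<forall>u \<in> Vs ! i. \<forall>u' \<in> Vs ! i.
        (\<Sum>w \<in> Vs ! j. graph_dist G u w) = (\<Sum>w \<in> Vs ! j. graph_dist G u' w))"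

definition is_distance_quotient_matrix ::
  "('a, 'b) pre_digraph \<Rightarrow> 'a set list \<Rightarrow> real mat \<Rightarrow> bool" where
  "is_distance_quotient_matrix G Vs Q \<longleftrightarrow>
     Q \<in> carrier_mat (length Vs) (length Vs) \<and>
     (\<forall>i < length Vs. \<forall>j < length Vs. \<forall>u \<in> Vs ! i.
        ereal (Q $$ (i, j)) = (\<Sum>w \<in> Vs ! j. graph_dist G u w))"

definition pi2 :: "('a, 'b) pre_digraph \<Rightarrow> 'a set \<Rightarrow> 'a set \<Rightarrow> 'a \<Rightarrow> 'a set list" where
  "pi2 G V1 V2 v = [{v}, V1 - {v}, nbhd G v, V2 - nbhd G v]"

definition P_mat :: "real \<Rightarrow> real \<Rightarrow> real \<Rightarrow> real mat" where
  "P_mat m d c = mat_of_rows_list 4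
     [[0, 2*m - 2,       d,         3*m - 3*d],
      [2, 2*m - 4,       3*d - 2*c, 3*m - 5*d + 2*c],
      [1, 3*m - 2*d - 1, 2*d - 2,   2*m - 2*d],
      [3, 3*m - 2*d - 3, 2*d,       2*m - 2*d - 2]]"

end

theory Submission
  imports Defs
begin

text \<open>
  Since \<open>c \<noteq> 0\<close>, two distinct vertices of the same part have a common neighbour and hence are at
  distance 2, while nonadjacent vertices of different parts are at distance 3. So the distances from
  \<open>u\<close> to a set \<open>S\<close> inside one part sum to \<open>2 |S| - 2 |S \<inter> {u}|\<close> or \<open>3 |S| - 2 |S \<inter> N(u)|\<close>, and the
  cells of the partition meet every neighbourhood in a number of vertices given by \<open>d\<close> and \<open>c\<close>.
  Excluding \<open>K\<^bsub>n,n\<^esub>\<close> is what makes the last cell nonempty.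
\<close>

section \<open>Walk lengths, distances and two-valued sums\<close>

lemma (in wf_digraph) graph_dist_eqI:
  assumes "awalk u p w" and "length p = n"
    and "\<And>q. awalk u q w \<Longrightarrow> n \<le> length q"
  shows "graph_dist G u w = ereal (real n)"
proof -
  \<comment> \<open>\<open>\<mu>\<close> is the infimum of the walk costs, and with unit weights the
    cost is the length: \<open>p\<close> bounds it from above, the third assumption from
    below.\<close>
  have cost: "awalk_cost (\<lambda>_. 1) q = real (length q)" for q :: "'b list"
    by (induction q) auto
  show ?thesis
    unfolding graph_dist_def \<mu>_def
  proof (rule antisym)
    show "(INF q\<in>{q. awalk u q w}. ereal (awalk_cost (\<lambda>_. 1) q)) \<le> ereal (real n)"
      using assms(1,2) by (intro INF_lower2[of p]) (auto simp: cost)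
    show "ereal (real n) \<le> (INF q\<in>{q. awalk u q w}. ereal (awalk_cost (\<lambda>_. 1) q))"
      using assms(3) by (intro INF_greatest) (auto simp: cost)
  qed
qed

text \<open>With the smaller value written as \<open>a - b\<close>, the sum depends on
  \<open>A\<close> only through \<open>card (S \<inter> A)\<close>. Taking \<open>b = 2\<close>
  serves both the distances 0, 2 and the distances 1, 3.\<close>

lemma sum_ereal_two_values:
  fixes a b :: real
  assumes "finite S"
  shows "(\<Sum>w\<in>S. ereal (if w \<in> A then a - b else a)) =
    ereal (a * real (card S) - b * real (card (S \<inter> A)))"
proof -
  have "(\<Sum>w\<in>S. if w \<in> A then a - b else a) = (\<Sum>w\<in>S. a - (if w \<in> A then b else 0))"
    by (intro sum.cong) auto
  also have "\<dots> = a * real (card S) - b * real (card (S \<inter> A))"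
    using assms by (simp add: sum_subtractf sum.inter_restrict[symmetric])
  finally show ?thesis by simp
qed

lemma bipartition_commute: "bipartition G V1 V2 \<longleftrightarrow> bipartition G V2 V1"
  unfolding bipartition_def by blast

lemma design_graph_commute: "design_graph G V1 V2 m d c \<longleftrightarrow> design_graph G V2 V1 m d c"
  unfolding design_graph_def using bipartition_commute[of G V1 V2]
  by (simp add: insert_commute)

text \<open>Each arc changes the part. This supplies the lower bounds on distances: no walk of
  length 1 stays in a part, and none of length 0 or 2 leads to the other part.\<close>

lemma (in wf_digraph) awalk_bipartite_parity:
  assumes "bipartition G V1 V2" and "awalk u p w"
  shows "even (length p) \<longleftrightarrow> (u \<in> V1 \<longleftrightarrow> w \<in> V1)"
  using assms(2)
proof (induction p arbitrary: u)
  case Nil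
  then show ?case by (simp add: awalk_Nil_iff)
next
  case (Cons e p)
  then have e: "e \<in> arcs G" "tail G e = u" "awalk (head G e) p w"
    by (auto simp: awalk_Cons_iff)
  then have "u \<rightarrow>\<^bsub>G\<^esub> head G e"
    by (auto simp: arcs_ends_conv)
  then have "u \<in> V1 \<longleftrightarrow> head G e \<notin> V1"
    using assms(1) unfolding bipartition_def by blast
  with Cons.IH[OF e(3)] show ?case by auto
qed

lemma (in wf_digraph) awalk_length_1_dominates:
  assumes "awalk u p w" and "length p = 1"
  shows "u \<rightarrow>\<^bsub>G\<^esub> w"
  using assms
  by (cases p) (auto simp: awalk_Cons_iff awalk_Nil_iff arcs_ends_conv)

lemma (in wf_digraph) awalk_Cons_dominates:
  assumes "u \<rightarrow>\<^bsub>G\<^esub> x" and "awalk x p w"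
  obtains e where "awalk u (e # p) w"
  using assms by (auto simp: awalk_Cons_iff elim!: reachableE)

section \<open>Degrees, common neighbours and part sizes\<close>

locale design = graph G for G :: "('a, 'b) pre_digraph" +
  fixes V1 V2 :: "'a set" and m d c :: nat
  assumes design: "design_graph G V1 V2 m d c"
begin

lemma bip: "bipartition G V1 V2"
  using design by (simp add: design_graph_def)

lemma verts_eq: "verts G = V1 \<union> V2" and parts_disjoint: "V1 \<inter> V2 = {}"
  using bip by (auto simp: bipartition_def)

lemma finite_parts: "finite V1" "finite V2"
  using finite_verts verts_eq by auto

lemma nbhd_sym: "x \<in> nbhd G y \<longleftrightarrow> y \<in> nbhd G x"
  using arcs_ends_symmetric[OF sym_arcs] by (auto simp: nbhd_def)

lemma nbhd_subset: "x \<in> V1 \<Longrightarrow> nbhd G x \<subseteq> V2" "x \<in> V2 \<Longrightarrow> nbhd G x \<subseteq> V1"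
  using bip unfolding bipartition_def nbhd_def by blast+

lemma card_nbhd:
  assumes "u \<in> verts G"
  shows "card (nbhd G u) = d"
proof -
  \<comment> \<open>The out-degree counts arcs; without parallel arcs, distinct arcs out of
    \<open>u\<close> have distinct heads, so it also counts neighbours.\<close>
  have "inj_on (head G) (out_arcs G u)"
    by (rule inj_onI) (auto intro!: no_multi_arcs simp: arc_to_ends_def)
  moreover have "head G ` out_arcs G u = nbhd G u"
    by (auto simp: nbhd_def arcs_ends_conv)
  ultimately have "card (nbhd G u) = out_degree G u"
    using card_image by (fastforce simp: out_degree_def)
  then show ?thesis using design assms by (simp add: design_graph_def)
qed

lemma card_common_nbhd:
  "\<lbrakk>x \<in> V1; y \<in> V1; x \<noteq> y\<rbrakk> \<Longrightarrow> card (nbhd G x \<inter> nbhd G y) = c"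
  "\<lbrakk>x \<in> V2; y \<in> V2; x \<noteq> y\<rbrakk> \<Longrightarrow> card (nbhd G x \<inter> nbhd G y) = c"
  using design by (auto simp: design_graph_def)

lemma c_pos: "0 < c" and m_ge_2: "2 \<le> m" and card_verts: "card V1 + card V2 = 2 * m"
  using design verts_eq parts_disjoint finite_parts
  by (auto simp: design_graph_def card_Un_disjoint)

lemma common_nbhd_nonempty:
  assumes "x \<in> V1 \<and> y \<in> V1 \<or> x \<in> V2 \<and> y \<in> V2" and "x \<noteq> y"
  obtains z where "z \<in> nbhd G x" "z \<in> nbhd G y"
proof -
  have "card (nbhd G x \<inter> nbhd G y) \<noteq> 0"
    using assms card_common_nbhd c_pos by auto
  then have "nbhd G x \<inter> nbhd G y \<noteq> {}" by auto
  then show thesis using that by blast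
qed

text \<open>The parts have at least 4 vertices together, so one of them has two vertices, and these
  share a neighbour. Equality of the part sizes cannot be invoked here, since its proof cancels the
  factor \<open>d\<close>.\<close>

lemma d_pos: "0 < d"
proof -
  have "\<exists>X\<in>{V1, V2}. 2 \<le> card X"
    using card_verts m_ge_2 by auto
  then obtain X where X: "X \<in> {V1, V2}" "2 \<le> card X" by blast
  then obtain x y where xy: "x \<in> X" "y \<in> X" "x \<noteq> y"
    by (meson card_2_iff' obtain_subset_with_card_n subset_iff)
  then obtain z where "z \<in> nbhd G x"
    using X(1) common_nbhd_nonempty[of x y] by auto
  moreover have "x \<in> verts G" using X(1) xy(1) verts_eq by auto
  moreover have "finite (nbhd G x)"
    using X(1) xy(1) nbhd_subset[of x] finite_parts by (auto dest: finite_subset)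
  ultimately show ?thesis using card_nbhd[of x] by (auto simp: card_gt_0_iff)
qed

text \<open>The parts have equal size because both \<open>d |V1|\<close> and \<open>d |V2|\<close> count the edges.\<close>

lemma card_parts: "card V1 = m" "card V2 = m"
proof -
  have deg: "card {y \<in> V2. y \<in> nbhd G x} = d" if "x \<in> V1" for x
  proof -
    have "{y \<in> V2. y \<in> nbhd G x} = nbhd G x"
      using nbhd_subset(1)[OF that] by blast
    then show ?thesis using card_nbhd[of x] that verts_eq by simp
  qed
  have "card {x \<in> V1. y \<in> nbhd G x} = d" if "y \<in> V2" for y
  proof -
    have "{x \<in> V1. y \<in> nbhd G x} = nbhd G y"
      using nbhd_subset(2)[OF that] nbhd_sym by blast
    then show ?thesis using card_nbhd[of y] that verts_eq by simp
  qed
  then have "(\<Sum>x\<in>V1. card {y \<in> V2. y \<in> nbhd G x}) = d * card V2"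
    using finite_parts by (intro sum_multicount) auto
  then have "d * card V1 = d * card V2" using deg by (simp add: mult.commute)
  then have "card V1 = card V2" using d_pos by auto
  then show "card V1 = m" "card V2 = m" using card_verts by auto
qed

text \<open>If \<open>d\<close> were at least \<open>m\<close>, each neighbourhood would fill the
  opposite part, and \<open>G\<close> would be the excluded complete bipartite graph with parts of
  size \<open>m\<close>.\<close>

lemma d_less_m: "d < m"
proof (rule ccontr)
  assume "\<not> d < m"
  have full1: "nbhd G x = V2" if "x \<in> V1" for x
    using nbhd_subset(1)[OF that] \<open>\<not> d < m\<close> card_nbhd[of x] that verts_eq
    by (intro card_seteq) (auto simp: finite_parts card_parts)
  have full2: "nbhd G x = V1" if "x \<in> V2" for x
    using nbhd_subset(2)[OF that] \<open>\<not> d < m\<close> card_nbhd[of x] that verts_eq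
    by (intro card_seteq) (auto simp: finite_parts card_parts)
  have "arcs_ends G = V1 \<times> V2 \<union> V2 \<times> V1"
  proof (intro equalityI subrelI)
    fix x y assume "x \<rightarrow>\<^bsub>G\<^esub> y"
    then show "(x, y) \<in> V1 \<times> V2 \<union> V2 \<times> V1"
      using bip unfolding bipartition_def by blast
  next
    fix x y assume "(x, y) \<in> V1 \<times> V2 \<union> V2 \<times> V1"
    then have "y \<in> nbhd G x" using full1 full2 by blast
    then show "x \<rightarrow>\<^bsub>G\<^esub> y" by (simp add: nbhd_def)
  qed
  then have "complete_bipartite_digraph m m G"
    unfolding complete_bipartite_digraph_def
    using graph_axioms verts_eq parts_disjoint card_parts by blast
  then show False using design by (auto simp: design_graph_def)
qed

section \<open>The distances 0, 1, 2, 3 and their sums over subsets of a part\<close>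

lemma graph_dist_self:
  assumes "u \<in> verts G"
  shows "graph_dist G u u = 0"
  using graph_dist_eqI[of u "[]" u 0] assms by (simp add: awalk_Nil_iff zero_ereal_def)

lemma graph_dist_same_part:
  assumes "u \<in> V1" and "w \<in> V1" and "u \<noteq> w"
  shows "graph_dist G u w = 2"
proof -
  obtain z where "z \<in> nbhd G u" "z \<in> nbhd G w"
    using common_nbhd_nonempty assms by blast
  then have z: "u \<rightarrow>\<^bsub>G\<^esub> z" "z \<rightarrow>\<^bsub>G\<^esub> w"
    using nbhd_sym[of z w] by (auto simp: nbhd_def)
  have "awalk w [] w" using assms verts_eq by (auto simp: awalk_Nil_iff)
  then obtain e where "awalk z [e] w" using awalk_Cons_dominates[OF z(2)] by blast
  then obtain f where f: "awalk u [f, e] w" using awalk_Cons_dominates[OF z(1)] by blast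
  have "2 \<le> length q" if q: "awalk u q w" for q
  proof -
    have "0 < length q" using q assms(3) by (auto simp: awalk_Nil_iff)
    moreover have "even (length q)"
      using awalk_bipartite_parity[OF bip q] assms by simp
    ultimately show ?thesis by presburger
  qed
  from graph_dist_eqI[OF f, of 2] this show ?thesis by simp
qed

lemma graph_dist_adjacent:
  assumes "w \<in> nbhd G u"
  shows "graph_dist G u w = 1"
proof -
  have uw: "u \<rightarrow>\<^bsub>G\<^esub> w" using assms by (simp add: nbhd_def)
  then have "awalk w [] w" by (simp add: awalk_Nil_iff adj_in_verts)
  then obtain e where e: "awalk u [e] w" using awalk_Cons_dominates[OF uw] by blast
  have "u \<noteq> w" using uw adj_not_same by blast
  then have "1 \<le> length q" if "awalk u q w" for q
    using that by (cases q) (auto simp: awalk_Nil_iff)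
  from graph_dist_eqI[OF e, of 1] this show ?thesis by simp
qed

lemma graph_dist_nonadjacent:
  assumes "u \<in> V1" and "w \<in> V2" and "w \<notin> nbhd G u"
  shows "graph_dist G u w = 3"
proof -
  have "card (nbhd G u) \<noteq> 0"
    using card_nbhd[of u] assms(1) verts_eq d_pos by auto
  \<comment> \<open>Any neighbour \<open>x\<close> of \<open>u\<close> lies in the part of
    \<open>w\<close>, so a common neighbour \<open>z\<close> of \<open>x\<close> and
    \<open>w\<close> completes a walk of length 3.\<close>
  then obtain x where x: "x \<in> nbhd G u"
    by (auto simp: card_eq_0_iff)
  then have "x \<in> V2" "x \<noteq> w" using nbhd_subset(1) assms by auto
  then obtain z where "z \<in> nbhd G x" "z \<in> nbhd G w"
    using common_nbhd_nonempty assms(2) by blast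
  then have z: "u \<rightarrow>\<^bsub>G\<^esub> x" "x \<rightarrow>\<^bsub>G\<^esub> z" "z \<rightarrow>\<^bsub>G\<^esub> w"
    using x nbhd_sym[of z w] by (auto simp: nbhd_def)
  have "awalk w [] w" using assms verts_eq by (auto simp: awalk_Nil_iff)
  then obtain e where "awalk z [e] w" using awalk_Cons_dominates[OF z(3)] by blast
  then obtain f where "awalk x [f, e] w" using awalk_Cons_dominates[OF z(2)] by blast
  then obtain g where g: "awalk u [g, f, e] w" using awalk_Cons_dominates[OF z(1)] by blast
  have "3 \<le> length q" if q: "awalk u q w" for q
  proof -
    have "length q \<noteq> 1"
      using awalk_length_1_dominates[OF q] assms(3) by (auto simp: nbhd_def)
    moreover have "odd (length q)"
      using awalk_bipartite_parity[OF bip q] assms parts_disjoint by auto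
    ultimately show ?thesis by presburger
  qed
  from graph_dist_eqI[OF g, of 3] this show ?thesis by simp
qed

lemma sum_graph_dist_same_part:
  assumes "u \<in> V1" and "S \<subseteq> V1"
  shows "(\<Sum>w\<in>S. graph_dist G u w) = ereal (2 * real (card S) - 2 * real (card (S \<inter> {u})))"
proof -
  have fin: "finite S" using assms(2) finite_parts finite_subset by blast
  have "(\<Sum>w\<in>S. graph_dist G u w) = (\<Sum>w\<in>S. ereal (if w \<in> {u} then 2 - 2 else 2))"
    using assms graph_dist_self[of u] graph_dist_same_part[of u] verts_eq
    by (intro sum.cong) (auto simp: subset_iff zero_ereal_def)
  also have "\<dots> = ereal (2 * real (card S) - 2 * real (card (S \<inter> {u})))"
    by (rule sum_ereal_two_values[OF fin])
  finally show ?thesis .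
qed

lemma sum_graph_dist_other_part:
  assumes "u \<in> V1" and "S \<subseteq> V2"
  shows "(\<Sum>w\<in>S. graph_dist G u w) = ereal (3 * real (card S) - 2 * real (card (S \<inter> nbhd G u)))"
proof -
  have fin: "finite S" using assms(2) finite_parts finite_subset by blast
  have "(\<Sum>w\<in>S. graph_dist G u w) = (\<Sum>w\<in>S. ereal (if w \<in> nbhd G u then 3 - 2 else 3))"
    using assms graph_dist_adjacent[of _ u] graph_dist_nonadjacent[of u]
    by (intro sum.cong) (auto simp: subset_iff one_ereal_def)
  also have "\<dots> = ereal (3 * real (card S) - 2 * real (card (S \<inter> nbhd G u)))"
    by (rule sum_ereal_two_values[OF fin])
  finally show ?thesis .
qed

end

text \<open>The distance lemmas start from a vertex of \<open>V1\<close>; exchanging the parts makes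
  them available for the rows of the two cells inside \<open>V2\<close>.\<close>

lemma design_swap:
  assumes "design G V1 V2 m d c"
  shows "design G V2 V1 m d c"
  using assms design_graph_commute[of G V1 V2 m d c]
  by (simp add: design_def design_axioms_def)

section \<open>The cells of the partition and the rows of the matrix\<close>

context design
begin

text \<open>Beyond disjointness, the point is that no cell is empty: this uses
  \<open>2 \<le> m\<close> for the second cell, \<open>0 < d\<close> for the third and
  \<open>d < m\<close> for the fourth.\<close>

lemma partition_pi2:
  assumes "v \<in> V1"
  shows "distinct (pi2 G V1 V2 v) \<and> partition_on (verts G) (set (pi2 G V1 V2 v))"
proof -
  have sub: "nbhd G v \<subseteq> V2" using nbhd_subset(1)[OF assms] .
  have card_v: "card (nbhd G v) = d" using card_nbhd assms verts_eq by auto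
  have ne2: "V1 - {v} \<noteq> {}"
  proof
    assume "V1 - {v} = {}"
    then have "V1 = {v}" using assms by auto
    then have "card V1 = 1" by simp
    then show False using card_parts m_ge_2 by simp
  qed
  have ne3: "nbhd G v \<noteq> {}" using card_v d_pos by auto
  have ne4: "V2 - nbhd G v \<noteq> {}"
  proof
    assume "V2 - nbhd G v = {}"
    then have "V2 = nbhd G v" using sub by auto
    then show False using card_v card_parts d_less_m by simp
  qed
  show ?thesis
    using sub ne2 ne3 ne4 assms verts_eq parts_disjoint
    unfolding pi2_def partition_on_def disjoint_def
    by auto
qed

lemma sum_graph_dist_pi2:
  assumes "v \<in> V1" and "i < 4" and "j < 4" and "u \<in> pi2 G V1 V2 v ! i"
  shows "(\<Sum>w\<in>pi2 G V1 V2 v ! j. graph_dist G u w) = ereal (P_mat m d c $$ (i, j))"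
proof -
  interpret swap: design G V2 V1 m d c
    using design_swap design_axioms .
  define A B N D where "A = {v}" and "B = V1 - {v}" and "N = nbhd G v" and "D = V2 - nbhd G v"
  note cell_defs = A_def B_def N_def D_def
  have sub: "A \<subseteq> V1" "B \<subseteq> V1" "N \<subseteq> V2" "D \<subseteq> V2"
    using assms(1) nbhd_subset(1)[OF assms(1)] by (auto simp: cell_defs)
  have finN: "finite N" using sub finite_parts finite_subset by blast
  have cardN: "card N = d" using card_nbhd assms(1) verts_eq by (auto simp: N_def)
  have cardB: "real (card B) = real m - 1"
    using assms(1) card_parts finite_parts m_ge_2 by (simp add: B_def of_nat_diff)
  have cardD: "real (card D) = real m - real d"
    using sub(3) finN cardN card_parts d_less_m
    by (simp add: D_def N_def[symmetric] card_Diff_subset of_nat_diff)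
  have cardA: "card A = 1" by (simp add: A_def)
  note cards = cardA cardB cardN cardD
  note sums = sum_graph_dist_same_part sum_graph_dist_other_part
    swap.sum_graph_dist_same_part swap.sum_graph_dist_other_part
  consider "u = v" "i = 0" | "u \<in> V1" "u \<noteq> v" "i = 1" | "u \<in> N" "i = 2"
    | "u \<in> V2" "u \<notin> N" "i = 3"
    using assms(2,4) by (auto simp: pi2_def N_def numeral_eq_Suc less_Suc_eq)
  \<comment> \<open>The four columns are treated together, because the position of \<open>u\<close>
    determines all four intersection sizes at once.\<close>
  then have "(\<Sum>w\<in>A. graph_dist G u w) = ereal (P_mat m d c $$ (i, 0)) \<and>
    (\<Sum>w\<in>B. graph_dist G u w) = ereal (P_mat m d c $$ (i, 1)) \<and>
    (\<Sum>w\<in>N. graph_dist G u w) = ereal (P_mat m d c $$ (i, 2)) \<and>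
    (\<Sum>w\<in>D. graph_dist G u w) = ereal (P_mat m d c $$ (i, 3))"
  proof cases
    case 1
    have "A \<inter> {u} = {v}" "B \<inter> {u} = {}" "N \<inter> nbhd G u = N" "D \<inter> nbhd G u = {}"
      using 1 by (auto simp: cell_defs)
    then have "card (A \<inter> {u}) = 1" "card (B \<inter> {u}) = 0"
      "card (N \<inter> nbhd G u) = d" "card (D \<inter> nbhd G u) = 0"
      using cardN by simp_all
    then show ?thesis
      using 1 assms(1) sub cards by (simp add: sums P_mat_def mat_of_rows_list_def)
  next
    case 2
    have "card (A \<inter> {u}) = 0" "card (B \<inter> {u}) = 1"
      using 2 by (auto simp: cell_defs)
    moreover have common: "card (N \<inter> nbhd G u) = c"
      using card_common_nbhd(1)[of v u] 2 assms(1) by (simp add: N_def)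
    \<comment> \<open>Of the \<open>d\<close> neighbours of \<open>u\<close>, exactly
      \<open>c\<close> lie in \<open>N\<close>, so \<open>d - c\<close> lie in \<open>D\<close>; the
      last entry is 3(m - d) - 2(d - c).\<close>
    moreover have "D \<inter> nbhd G u = nbhd G u - N \<inter> nbhd G u"
      using nbhd_subset(1)[OF 2(1)] by (auto simp: cell_defs)
    moreover have "card (nbhd G u) = d" using card_nbhd 2(1) verts_eq by auto
    \<comment> \<open>This gives \<open>c \<le> d\<close>, so that the subtraction of naturals is
      not truncated.\<close>
    moreover have "card (N \<inter> nbhd G u) \<le> card N" using finN by (auto intro: card_mono)
    ultimately have "card (A \<inter> {u}) = 0" "card (B \<inter> {u}) = 1" "card (N \<inter> nbhd G u) = c"
      "real (card (D \<inter> nbhd G u)) = real d - real c"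
      using finN cardN by (simp_all add: card_Diff_subset of_nat_diff)
    then show ?thesis
      using 2 sub cards by (simp add: sums P_mat_def mat_of_rows_list_def)
  next
    case 3
    then have u: "u \<in> V2" using sub by auto
    have v: "v \<in> nbhd G u" using 3 nbhd_sym by (simp add: N_def)
    \<comment> \<open>One neighbour of \<open>u\<close> is \<open>v\<close> itself, which leaves
      \<open>d - 1\<close> in \<open>B\<close>: the entry is 3(m - 1) - 2(d - 1).\<close>
    have "A \<inter> nbhd G u = {v}" "N \<inter> {u} = {u}" "D \<inter> {u} = {}" "B \<inter> nbhd G u = nbhd G u - {v}"
      using v 3 nbhd_subset(2)[OF u] by (auto simp: cell_defs)
    moreover have "card (nbhd G u) = d" using card_nbhd u verts_eq by auto
    ultimately have "card (A \<inter> nbhd G u) = 1" "card (N \<inter> {u}) = 1" "card (D \<inter> {u}) = 0"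
      "real (card (B \<inter> nbhd G u)) = real d - 1"
      using v d_pos by (simp_all add: of_nat_diff)
    then show ?thesis
      using 3 u sub cards by (simp add: sums P_mat_def mat_of_rows_list_def)
  next
    case 4
    have v: "v \<notin> nbhd G u" using 4 nbhd_sym by (simp add: N_def)
    \<comment> \<open>Here \<open>v\<close> is not adjacent to \<open>u\<close>, so all
      \<open>d\<close> neighbours lie in \<open>B\<close>: the entry is 3(m - 1) - 2d.\<close>
    have "A \<inter> nbhd G u = {}" "N \<inter> {u} = {}" "D \<inter> {u} = {u}" "B \<inter> nbhd G u = nbhd G u"
      using v 4 nbhd_subset(2)[OF 4(1)] by (auto simp: cell_defs)
    moreover have "card (nbhd G u) = d" using card_nbhd 4(1) verts_eq by auto
    ultimately have "card (A \<inter> nbhd G u) = 0" "card (N \<inter> {u}) = 0" "card (D \<inter> {u}) = 1"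
      "card (B \<inter> nbhd G u) = d"
      by simp_all
    then show ?thesis
      using 4 sub cards by (simp add: sums P_mat_def mat_of_rows_list_def)
  qed
  moreover have "j = 0 \<or> j = 1 \<or> j = 2 \<or> j = 3" using assms(3) by auto
  ultimately show ?thesis by (auto simp: pi2_def cell_defs)
qed

end

theorem theorem2p3:
  fixes G :: "('a, 'b) pre_digraph" and V1 V2 :: "'a set" and m d c :: nat and v :: 'a
  assumes "design_graph G V1 V2 m d c"
    and "v \<in> V1"
  shows "distance_equitable_partition G (pi2 G V1 V2 v) \<and>
    is_distance_quotient_matrix G (pi2 G V1 V2 v) (P_mat (real m) (real d) (real c))"
proof -
  interpret design G V1 V2 m d c
    using assms(1) by (simp add: design_def design_axioms_def design_graph_def)
  have len: "length (pi2 G V1 V2 v) = 4" by (simp add: pi2_def)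
  have "P_mat (real m) (real d) (real c) \<in> carrier_mat 4 4"
    by (auto simp: P_mat_def mat_of_rows_list_def)
  \<comment> \<open>Equitability follows from the matrix entries: each sum equals an entry that
    depends only on the cell indices.\<close>
  then show ?thesis
    unfolding distance_equitable_partition_def is_distance_quotient_matrix_def len
    using partition_pi2[OF assms(2)] sum_graph_dist_pi2[OF assms(2)] by simp
qed

end
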